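(* Let $n,p\ge 1$ be integers satisfying $$n \ge p + \frac12 + \sqrt{2p+\frac14}.$$ Then the set $$\left\{X\in\mathbb{R}^{n\times p} : X^\top X \text{ is invertible and } Q\odot Q \text{ does not have full rank}\right\},\qquad Q = I_n - X(X^\top X)^{-1}X^\top,$$ has Lebesgue measure zero in $\mathbb{R}^{np}$.
   Context: $I_n$ is the $n\times n$ identity matrix, and $\mathbb{R}^{n\times p}$ is identified with $\mathbb{R}^{np}$. For a matrix $M$, $M\odot M$ denotes the Hadamard (entrywise) product of $M$ with itself, i.e. $(M\odot M)_{ij}=M_{ij}^2$. "Full rank" for the $n\times n$ matrix $Q\odot Q$ means rank $n$. *)

theory Defs
  imports "HOL-Analysis.Analysis"
begin

definition hadamard :: "'a::times^'n^'m \<Rightarrow> 'a^'n^'m \<Rightarrow> 'a^'n^'m"  (infixl \<open>\<odot>\<close> 70)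
  where "A \<odot> B = (\<chi> i j. A $ i $ j * B $ i $ j)"

(* matrix_inv is unspecified on singular matrices, so this is meaningful
   only when transpose X ** X is invertible. *)
definition resid_proj :: "real^'p^'n \<Rightarrow> real^'n^'n"
  where "resid_proj X = mat 1 - X ** matrix_inv (transpose X ** X) ** transpose X"

end

theory Submission
  imports Defs
begin

text \<open>
  Write \<open>A = X\<^sup>T X\<close>, \<open>Q\<close> for the residual projection of \<open>X\<close>, and \<open>m = n - p\<close>. Where \<open>A\<close> is
  invertible, singularity of \<open>Q \<odot> Q\<close> is a polynomial condition on \<open>X\<close>: multiplying \<open>Q\<close> by \<open>det A\<close>
  replaces the inverse of \<open>A\<close> by its adjugate, so that the Hadamard square of \<open>det A * Q\<close> has a
  determinant polynomial in \<open>X\<close> (\<open>det_cleared_eq_0_iff\<close>,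
  \<open>real_polynomial_function_det_cleared\<close>). The zero set of a polynomial that is not identically
  zero is null (\<open>null_sets_real_polynomial_zeros\<close>), so a single \<open>X\<close> with \<open>A\<close> invertible and
  \<open>Q \<odot> Q\<close> nonsingular suffices.

  Such an \<open>X\<close> is found by looking at the kernel of \<open>Q \<odot> Q\<close>. If \<open>(Q \<odot> Q) a = 0\<close> and
  \<open>D = diag a\<close>, then the squared Frobenius norm of \<open>Q D Q\<close>, which is the trace of \<open>Q D Q D\<close>,
  vanishes. Hence \<open>u\<^sup>T D w = 0\<close> for all \<open>u\<close>, \<open>w\<close> in the range of \<open>Q\<close>, the kernel of \<open>X\<^sup>T\<close>
  (\<open>hadamard_kernel_annihilates_products\<close>). If the rows \<open>v\<^sub>1, ..., v\<^sub>n\<close> of a matrix \<open>V\<close> with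
  \<open>m\<close> columns are such that the columns lie in this kernel, this says that the symmetric matrices
  \<open>v\<^sub>r v\<^sub>r\<^sup>T\<close> satisfy the linear relation with coefficients \<open>a\<close>. The hypothesis on \<open>n\<close> and \<open>p\<close>
  is equivalent to \<open>m \<ge> 1\<close> and \<open>m (m - 1) / 2 \<ge> p\<close>, so that \<open>m + p\<close> independent such matrices
  are available: take the \<open>m\<close> unit vectors and \<open>p\<close> distinct sums of two of them. The
  corresponding \<open>X\<close> is written down in \<open>exists_nonsingular_hadamard_square\<close>.
\<close>

section \<open>Null sets from lines through a point\<close>

text \<open>
  Stretch a bounded piece \<open>S\<close> of \<open>Z\<close> about \<open>a\<close> by the factors \<open>1 + 1 / (k + 1)\<close>. Every stretched copy
  has at least the measure of \<open>S\<close>, and all of them lie in one ball. But a fixed point belongs to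
  only finitely many copies, since otherwise the line joining it to \<open>a\<close> would meet \<open>Z\<close> infinitely
  often. So the tail unions of the copies decrease to the empty set, and their measures, which
  bound that of \<open>S\<close>, tend to zero.
\<close>
lemma null_sets_if_finite_on_lines_through:
  fixes Z :: "'a::euclidean_space set"
  assumes Z: "Z \<in> sets lebesgue"
    and fin: "\<And>v. finite {t::real. a + t *\<^sub>R v \<in> Z}"
  shows "Z \<in> null_sets lebesgue"
proof -
  have bounded_part: "Z \<inter> cball a (real N) \<in> null_sets lebesgue" for N
  proof -
    define S where "S = Z \<inter> cball a (real N)"
    define c where "c k = 1 + 1 / (real k + 1)" for k :: nat
    \<comment> \<open>\<open>H k\<close> is the copy of \<open>S\<close> stretched by \<open>c k\<close> about \<open>a\<close>.\<close>
    define H where "H k = (\<lambda>x. c k *\<^sub>R x + (a - c k *\<^sub>R a)) ` S" for k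
    define B where "B k = (\<Union>j\<in>{k..}. H j)" for k
    have c: "1 \<le> c k" "c k \<le> 2" for k
      by (auto simp: c_def field_simps)
    have c_inj: "c j = c k \<longleftrightarrow> j = k" for j k
      by (auto simp: c_def field_simps)
    have S: "S \<in> sets lebesgue"
      using Z by (auto simp: S_def)
    have memH: "x \<in> H k \<longleftrightarrow> a + (1 / c k) *\<^sub>R (x - a) \<in> S" for x k
    proof
      assume "x \<in> H k"
      then obtain y where y: "y \<in> S" "x = c k *\<^sub>R y + (a - c k *\<^sub>R a)"
        by (auto simp: H_def)
      then have "x - a = c k *\<^sub>R (y - a)"
        by (simp add: algebra_simps)
      then have "a + (1 / c k) *\<^sub>R (x - a) = y"
        using c[of k] by simp
      then show "a + (1 / c k) *\<^sub>R (x - a) \<in> S" using y by simp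
    next
      assume *: "a + (1 / c k) *\<^sub>R (x - a) \<in> S"
      have "x = c k *\<^sub>R (a + (1 / c k) *\<^sub>R (x - a)) + (a - c k *\<^sub>R a)"
        using c[of k] by (simp add: scaleR_add_right)
      then show "x \<in> H k" unfolding H_def by (rule image_eqI) (rule *)
    qed
    have measH: "H k \<in> sets lebesgue" for k
    proof -
      have "H k = (+) (a - c k *\<^sub>R a) ` ((*\<^sub>R) (1 / c k) -` S)"
      proof (intro set_eqI iffI)
        fix x assume "x \<in> H k"
        then obtain y where "y \<in> S" "x = c k *\<^sub>R y + (a - c k *\<^sub>R a)"
          by (auto simp: H_def)
        then show "x \<in> (+) (a - c k *\<^sub>R a) ` ((*\<^sub>R) (1 / c k) -` S)"
          using c[of k] by (intro image_eqI[of _ _ "c k *\<^sub>R y"]) auto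
      next
        fix x assume "x \<in> (+) (a - c k *\<^sub>R a) ` ((*\<^sub>R) (1 / c k) -` S)"
        then obtain y where "(1 / c k) *\<^sub>R y \<in> S" "x = (a - c k *\<^sub>R a) + y"
          by auto
        then show "x \<in> H k"
          unfolding H_def using c[of k] by (intro image_eqI[of _ _ "(1 / c k) *\<^sub>R y"]) auto
      qed
      moreover have "(*\<^sub>R) (1 / c k) -` S \<in> sets lebesgue"
        using measurable_sets[OF lebesgue_measurable_scaling S] by simp
      ultimately show ?thesis
        using lebesgue_sets_translation by metis
    qed
    have emH: "emeasure lebesgue S \<le> emeasure lebesgue (H k)" for k
    proof -
      have "emeasure lebesgue (H k) = \<bar>c k\<bar> ^ DIM('a) * emeasure lebesgue S"
        unfolding H_def by (rule emeasure_lebesgue_affine)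
      moreover have "1 \<le> \<bar>c k\<bar> ^ DIM('a)"
        using c[of k] by (intro one_le_power) auto
      then have "1 * emeasure lebesgue S \<le> ennreal (\<bar>c k\<bar> ^ DIM('a)) * emeasure lebesgue S"
        by (intro mult_right_mono) (auto simp: ennreal_1[symmetric] simp del: ennreal_1)
      ultimately show ?thesis by simp
    qed
    have measB: "B k \<in> sets lebesgue" for k
      unfolding B_def using measH by auto
    have "H k \<subseteq> cball a (2 * real N)" for k
    proof
      fix x assume "x \<in> H k"
      then have "norm ((1 / c k) *\<^sub>R (x - a)) \<le> real N"
        by (auto simp: memH S_def dist_norm)
      then have "norm (x - a) \<le> c k * real N"
        using c[of k] by (simp only: norm_scaleR) (simp add: field_simps)
      also have "\<dots> \<le> 2 * real N"
        using c[of k] by (intro mult_right_mono) auto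
      finally show "x \<in> cball a (2 * real N)"
        by (simp add: dist_norm norm_minus_commute)
    qed
    then have "B k \<subseteq> cball a (2 * real N)" for k
      by (auto simp: B_def)
    then have "emeasure lebesgue (B k) \<le> emeasure lebesgue (cball a (2 * real N))" for k
      by (intro emeasure_mono) auto
    moreover have "emeasure lebesgue (cball a (2 * real N)) < \<infinity>"
      using lmeasurable_cball[of a "2 * real N"] by (simp add: fmeasurable_def)
    ultimately have finB: "emeasure lebesgue (B k) \<noteq> \<infinity>" for k
      by (metis leD top.not_eq_extremum infinity_ennreal_def)
    have "decseq B"
      by (force simp: decseq_def B_def)
    have "(\<Inter>k. B k) = {}"
    proof (rule ccontr)
      assume "(\<Inter>k. B k) \<noteq> {}"
      then obtain x where x: "\<And>k. x \<in> B k" by auto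
      have "{k. x \<in> H k} \<subseteq> (\<lambda>k. 1 / c k) -` {t. a + t *\<^sub>R (x - a) \<in> Z}"
        by (auto simp: memH S_def)
      moreover have "inj (\<lambda>k. 1 / c k)"
        using c_inj c by (auto simp: inj_def field_simps)
      ultimately have "finite {k. x \<in> H k}"
        using fin[of "x - a"] finite_vimageI finite_subset by metis
      moreover have "infinite {k. x \<in> H k}"
        unfolding infinite_nat_iff_unbounded_le using x by (force simp: B_def)
      ultimately show False by simp
    qed
    then have "(\<lambda>k. emeasure lebesgue (B k)) \<longlonglongrightarrow> 0"
      using Lim_emeasure_decseq[of B lebesgue] measB \<open>decseq B\<close> finB by auto
    moreover have "emeasure lebesgue S \<le> emeasure lebesgue (B k)" for k
      using emH[of k] emeasure_mono[of "H k" "B k" lebesgue] measB[of k]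
      by (force simp: B_def intro: order_trans)
    ultimately have "emeasure lebesgue S \<le> 0"
      by (intro LIMSEQ_le_const) auto
    then show ?thesis using S by (auto simp: S_def null_sets_def)
  qed
  have "Z = (\<Union>N. Z \<inter> cball a (real N))"
    using real_arch_simple by fastforce
  moreover have "(\<Union>N. Z \<inter> cball a (real N)) \<in> null_sets lebesgue"
    using bounded_part by (intro null_sets_UN') auto
  ultimately show ?thesis by simp
qed

text \<open>
  On each line through a point where \<open>f\<close> does not vanish, \<open>f\<close> is a nonzero polynomial in one
  variable.
\<close>
lemma null_sets_real_polynomial_zeros:
  fixes f :: "'a::euclidean_space \<Rightarrow> real"
  assumes f: "real_polynomial_function f" and a: "f a \<noteq> 0"
  shows "{x. f x = 0} \<in> null_sets lebesgue"
proof (rule null_sets_if_finite_on_lines_through)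
  have "closed {x. f x = 0}"
    using f by (intro closed_Collect_eq continuous_intros)
       (auto intro: continuous_on_polymonial_function simp: real_polynomial_function_eq)
  then show "{x. f x = 0} \<in> sets lebesgue"
    by (simp add: borel_closed)
next
  fix v :: 'a
  have "polynomial_function (\<lambda>t::real. a + t *\<^sub>R v)"
    by (intro polynomial_function_add polynomial_function_const polynomial_function_bounded_linear
        bounded_linear_scaleR_left)
  then have "real_polynomial_function (\<lambda>t. f (a + t *\<^sub>R v))"
    using real_polynomial_function_compose[OF _ f] by (force simp: o_def)
  then obtain b n where b: "(\<lambda>t. f (a + t *\<^sub>R v)) = (\<lambda>t. \<Sum>i\<le>n. b i * t ^ i)"
    by (auto simp: real_polynomial_function_iff_sum)
  have "\<exists>k\<le>n. b k \<noteq> 0"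
    using fun_cong[OF b, of 0] a by fastforce
  then show "finite {t. a + t *\<^sub>R v \<in> {x. f x = 0}}"
    using polyfun_finite_roots[of b n] by (simp add: fun_cong[OF b])
qed

section \<open>The singular locus as part of a polynomial zero set\<close>

text \<open>
  The entries are written in the form in which Cramer's rule produces them, which makes the link
  to the inverse immediate and keeps them visibly polynomial in \<open>A\<close>.
\<close>
definition adjugate :: "'a::field^'n^'n \<Rightarrow> 'a^'n^'n" where
  "adjugate A = (\<chi> k j. det (\<chi> i l. if l = k then axis j 1 $ i else A $ i $ l))"

lemma matrix_inv_works:
  assumes "invertible A"
  shows "A ** matrix_inv A = mat 1" "matrix_inv A ** A = mat 1"
  using someI_ex[OF assms[unfolded invertible_def]] by (auto simp: matrix_inv_def)

lemma matrix_inv_entry_adjugate: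
  fixes A :: "'a::field^'n^'n"
  assumes "invertible A"
  shows "det A * matrix_inv A $ k $ j = adjugate A $ k $ j"
proof -
  have d: "det A \<noteq> 0" using assms invertible_det_nz by blast
  have "A *v column j (matrix_inv A) = axis j 1"
    using matrix_inv_works(1)[OF assms]
    by (simp add: vec_eq_iff matrix_vector_mult_def matrix_matrix_mult_def column_def mat_def axis_def)
  then have "column j (matrix_inv A) $ k = adjugate A $ k $ j / det A"
    unfolding cramer[OF d] by (simp add: adjugate_def)
  then show ?thesis using d by (simp add: column_def)
qed

text \<open>
  The residual projection with its denominator \<open>det (X\<^sup>T X)\<close> cleared; unlike \<open>resid_proj\<close> it is
  polynomial in \<open>X\<close> everywhere.
\<close>
definition cleared_resid_proj :: "real^'p^'n \<Rightarrow> real^'n^'n" where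
  "cleared_resid_proj X =
     det (transpose X ** X) *\<^sub>R mat 1 - X ** adjugate (transpose X ** X) ** transpose X"

lemma cleared_resid_proj_eq:
  fixes X :: "real^'p^'n"
  assumes "invertible (transpose X ** X)"
  shows "cleared_resid_proj X = det (transpose X ** X) *\<^sub>R resid_proj X"
proof -
  let ?A = "transpose X ** X"
  have "adjugate ?A = det ?A *\<^sub>R matrix_inv ?A"
    using matrix_inv_entry_adjugate[OF assms] by (simp add: vec_eq_iff)
  then show ?thesis
    by (simp add: cleared_resid_proj_def resid_proj_def scaleR_diff_right
        scalar_matrix_assoc matrix_scalar_ac)
qed

lemma hadamard_scaleR: "(c *\<^sub>R A) \<odot> (c *\<^sub>R A) = (c * c) *\<^sub>R (A \<odot> (A::real^'n^'m))"
  by (simp add: hadamard_def vec_eq_iff)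

lemma det_cleared_eq_0_iff:
  fixes X :: "real^'p^'n"
  assumes "invertible (transpose X ** X)"
  shows "det (cleared_resid_proj X \<odot> cleared_resid_proj X) = 0 \<longleftrightarrow>
         rank (resid_proj X \<odot> resid_proj X) \<noteq> CARD('n)"
proof -
  let ?d = "det (transpose X ** X)"
  have d: "?d \<noteq> 0" using assms invertible_det_nz by blast
  have "det (cleared_resid_proj X \<odot> cleared_resid_proj X) = 0 \<longleftrightarrow>
      (\<exists>a. a \<noteq> 0 \<and> (cleared_resid_proj X \<odot> cleared_resid_proj X) *v a = 0)"
    using rank_bound[of "cleared_resid_proj X \<odot> cleared_resid_proj X"]
    by (auto simp: det_eq_0_rank matrix_nonfull_linear_equations_eq)
  also have "\<dots> \<longleftrightarrow> (\<exists>a. a \<noteq> 0 \<and> (resid_proj X \<odot> resid_proj X) *v a = 0)"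
    using d by (simp add: cleared_resid_proj_eq[OF assms] hadamard_scaleR
        scaleR_matrix_vector_assoc[symmetric])
  also have "\<dots> \<longleftrightarrow> rank (resid_proj X \<odot> resid_proj X) \<noteq> CARD('n)"
    by (rule matrix_nonfull_linear_equations_eq)
  finally show ?thesis .
qed

lemma real_polynomial_function_det:
  fixes F :: "'a::real_normed_vector \<Rightarrow> real^'n^'n"
  assumes "\<And>i j. real_polynomial_function (\<lambda>x. F x $ i $ j)"
  shows "real_polynomial_function (\<lambda>x. det (F x))"
  unfolding det_def using assms
  by (intro real_polynomial_function_sum real_polynomial_function.intros(4) real_polynomial_function_prod
      real_polynomial_function.intros(2)) (auto simp: finite_permutations)

lemma real_polynomial_function_matrix_mult:
  fixes F :: "'a::real_normed_vector \<Rightarrow> real^'n^'m" and G :: "'a \<Rightarrow> real^'k^'n"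
  assumes "\<And>i j. real_polynomial_function (\<lambda>x. F x $ i $ j)"
    and "\<And>i j. real_polynomial_function (\<lambda>x. G x $ i $ j)"
  shows "real_polynomial_function (\<lambda>x. (F x ** G x) $ i $ j)"
  using assms unfolding matrix_matrix_mult_def vec_lambda_beta
  by (intro real_polynomial_function_sum real_polynomial_function.intros(4)) auto

lemma real_polynomial_function_det_cleared:
  "real_polynomial_function
     (\<lambda>X::real^'p^'n. det (cleared_resid_proj X \<odot> cleared_resid_proj X))"
proof -
  have X: "real_polynomial_function (\<lambda>X::real^'p^'n. X $ i $ j)" for i j
    by (intro real_polynomial_function.intros(1) bounded_linear_compose[OF bounded_linear_vec_nth]
        bounded_linear_vec_nth)
  have XT: "real_polynomial_function (\<lambda>X::real^'p^'n. transpose X $ i $ j)" for i j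
    using X by (simp add: transpose_def)
  have A: "real_polynomial_function (\<lambda>X::real^'p^'n. (transpose X ** X) $ i $ j)" for i j
    by (rule real_polynomial_function_matrix_mult[OF XT X])
  have "real_polynomial_function (\<lambda>X::real^'p^'n. if l = k then c else (transpose X ** X) $ i $ l)"
    for i k l and c :: real
    by (cases "l = k") (auto intro: A)
  then have adj: "real_polynomial_function (\<lambda>X::real^'p^'n. adjugate (transpose X ** X) $ i $ j)" for i j
    by (auto simp: adjugate_def intro!: real_polynomial_function_det)
  have C: "real_polynomial_function (\<lambda>X::real^'p^'n. cleared_resid_proj X $ i $ j)" for i j
    unfolding cleared_resid_proj_def vector_minus_component vector_scaleR_component
    by (auto intro!: real_polynomial_function_diff real_polynomial_function.intros(4)
        real_polynomial_function_matrix_mult real_polynomial_function_det X XT A adj)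
  show ?thesis
    by (rule real_polynomial_function_det) (auto simp: hadamard_def intro!: real_polynomial_function.intros(4) C)
qed

section \<open>The kernel of the Hadamard square\<close>

lemma resid_proj_symmetric:
  fixes X :: "real^'p^'n"
  assumes "invertible (transpose X ** X)"
  shows "transpose (resid_proj X) = resid_proj X"
proof -
  let ?A = "transpose X ** X" let ?B = "matrix_inv ?A"
  have "transpose ?A = ?A" by (simp add: matrix_transpose_mul)
  then have "transpose ?B ** ?A = mat 1"
    using matrix_inv_works(1)[OF assms] by (metis matrix_transpose_mul transpose_mat)
  then have "transpose ?B = ?B"
    using matrix_inv_works(1)[OF assms] by (metis matrix_mul_assoc matrix_mul_lid matrix_mul_rid)
  then have "transpose (X ** ?B ** transpose X) = X ** ?B ** transpose X"
    by (simp add: matrix_transpose_mul matrix_mul_assoc)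
  then show ?thesis
    by (simp add: resid_proj_def vec_eq_iff transpose_def mat_def)
qed

lemma resid_proj_fixes_kernel:
  fixes X :: "real^'p^'n"
  assumes "transpose X *v u = 0"
  shows "resid_proj X *v u = u"
  using assms
  by (simp add: resid_proj_def matrix_vector_mult_diff_rdistrib matrix_vector_mul_assoc[symmetric]
      del: transpose_matrix_vector)

lemma resid_proj_idempotent:
  fixes X :: "real^'p^'n"
  assumes "invertible (transpose X ** X)"
  shows "resid_proj X ** resid_proj X = resid_proj X"
proof -
  let ?A = "transpose X ** X" let ?B = "matrix_inv ?A"
  have "transpose X *v (resid_proj X *v u) = transpose X *v u - (?A ** ?B) *v (transpose X *v u)" for u
    by (simp only: resid_proj_def matrix_vector_mult_diff_rdistrib matrix_vector_mult_diff_distrib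
        matrix_vector_mul_assoc matrix_mul_assoc matrix_mul_rid)
  then have "transpose X *v (resid_proj X *v u) = 0" for u
    by (simp only: matrix_inv_works(1)[OF assms] matrix_vector_mul_lid diff_self)
  then have "(resid_proj X ** resid_proj X) *v u = resid_proj X *v u" for u
    by (simp only: matrix_vector_mul_assoc[symmetric] resid_proj_fixes_kernel)
  then show ?thesis by (simp add: matrix_eq)
qed

text \<open>
  With \<open>D = diag a\<close> the conclusion is \<open>Q D Q = 0\<close>. Because \<open>Q\<close> is a symmetric idempotent,
  the sum of the squared entries of \<open>Q D Q\<close> is the trace of \<open>Q D Q D\<close>, which is the quadratic
  form of \<open>Q \<odot> Q\<close> at \<open>a\<close>.
\<close>
lemma hadamard_square_kernel:
  fixes Q :: "real^'n^'n"
  assumes sym: "transpose Q = Q" and idem: "Q ** Q = Q" and ker: "(Q \<odot> Q) *v a = 0"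
  shows "(\<Sum>r\<in>UNIV. Q $ i $ r * a $ r * Q $ r $ j) = 0"
proof -
  define M where "M i j = (\<Sum>r\<in>UNIV. Q $ i $ r * a $ r * Q $ r $ j)" for i j
  have s: "Q $ i $ j = Q $ j $ i" for i j
    using sym by (metis transpose_def vec_lambda_beta)
  have q: "(\<Sum>i\<in>UNIV. Q $ r $ i * Q $ i $ t) = Q $ r $ t" for r t
    using idem by (metis (mono_tags, lifting) matrix_matrix_mult_def sum.cong vec_lambda_beta)
  have "(\<Sum>i\<in>UNIV. \<Sum>j\<in>UNIV. (M i j)\<^sup>2) =
      (\<Sum>i\<in>UNIV. \<Sum>j\<in>UNIV. \<Sum>r\<in>UNIV. \<Sum>t\<in>UNIV.
        a $ r * a $ t * (Q $ r $ i * Q $ i $ t) * (Q $ r $ j * Q $ j $ t))"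
    unfolding M_def power2_eq_square sum_product
    by (intro sum.cong refl) (simp add: s mult_ac)
  also have "\<dots> = (\<Sum>r\<in>UNIV. \<Sum>t\<in>UNIV. \<Sum>i\<in>UNIV. \<Sum>j\<in>UNIV.
        a $ r * a $ t * (Q $ r $ i * Q $ i $ t) * (Q $ r $ j * Q $ j $ t))"
    (is "(\<Sum>i\<in>?U. \<Sum>j\<in>?U. \<Sum>r\<in>?U. \<Sum>t\<in>?U. ?g i j r t) = _")
  proof -
    have "(\<Sum>i\<in>?U. \<Sum>j\<in>?U. \<Sum>r\<in>?U. \<Sum>t\<in>?U. ?g i j r t) =
        (\<Sum>i\<in>?U. \<Sum>r\<in>?U. \<Sum>j\<in>?U. \<Sum>t\<in>?U. ?g i j r t)"
      by (rule sum.cong[OF refl], rule sum.swap)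
    also have "\<dots> = (\<Sum>r\<in>?U. \<Sum>i\<in>?U. \<Sum>j\<in>?U. \<Sum>t\<in>?U. ?g i j r t)"
      by (rule sum.swap)
    also have "\<dots> = (\<Sum>r\<in>?U. \<Sum>i\<in>?U. \<Sum>t\<in>?U. \<Sum>j\<in>?U. ?g i j r t)"
      by (rule sum.cong[OF refl], rule sum.cong[OF refl], rule sum.swap)
    also have "\<dots> = (\<Sum>r\<in>?U. \<Sum>t\<in>?U. \<Sum>i\<in>?U. \<Sum>j\<in>?U. ?g i j r t)"
      by (rule sum.cong[OF refl], rule sum.swap)
    finally show ?thesis .
  qed
  also have "\<dots> = (\<Sum>r\<in>UNIV. \<Sum>t\<in>UNIV. a $ r * a $ t * Q $ r $ t * Q $ r $ t)"
    by (simp only: sum_distrib_left[symmetric] sum_distrib_right[symmetric] q)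
  also have "\<dots> = (\<Sum>r\<in>UNIV. a $ r * ((Q \<odot> Q) *v a) $ r)"
    by (simp add: hadamard_def matrix_vector_mult_def sum_distrib_left mult_ac)
  also have "\<dots> = 0" using ker by simp
  finally have "(M i j)\<^sup>2 = 0"
    by (simp add: sum_nonneg sum_nonneg_eq_0_iff)
  then show ?thesis by (simp add: M_def)
qed

text \<open>
  Vectors in the kernel of \<open>X\<^sup>T\<close> are fixed by the projection \<open>Q\<close>, so
  \<open>u\<^sup>T D w = u\<^sup>T (Q D Q) w = 0\<close>. This removes \<open>Q\<close>, and with it the matrix inverse, from the
  problem.
\<close>
lemma hadamard_kernel_annihilates_products:
  fixes X :: "real^'p^'n"
  assumes inv: "invertible (transpose X ** X)"
    and ker: "(resid_proj X \<odot> resid_proj X) *v a = 0"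
    and u: "transpose X *v u = 0" and w: "transpose X *v w = 0"
  shows "(\<Sum>r\<in>UNIV. a $ r * u $ r * w $ r) = 0"
proof -
  let ?Q = "resid_proj X"
  have s: "?Q $ i $ j = ?Q $ j $ i" for i j
    using resid_proj_symmetric[OF inv] by (metis transpose_def vec_lambda_beta)
  have fixed: "u $ r = (\<Sum>i\<in>UNIV. ?Q $ i $ r * u $ i)" "w $ r = (\<Sum>j\<in>UNIV. ?Q $ r $ j * w $ j)" for r
    using arg_cong[OF resid_proj_fixes_kernel[OF u], of "\<lambda>v. v $ r"]
      arg_cong[OF resid_proj_fixes_kernel[OF w], of "\<lambda>v. v $ r"]
    by (simp_all add: matrix_vector_mult_def s)
  have "(\<Sum>r\<in>UNIV. a $ r * u $ r * w $ r) =
      (\<Sum>r\<in>UNIV. a $ r * (\<Sum>i\<in>UNIV. ?Q $ i $ r * u $ i) * (\<Sum>j\<in>UNIV. ?Q $ r $ j * w $ j))"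
    by (simp only: fixed[symmetric])
  also have "\<dots> = (\<Sum>r\<in>UNIV. \<Sum>i\<in>UNIV. \<Sum>j\<in>UNIV. u $ i * w $ j * (?Q $ i $ r * a $ r * ?Q $ r $ j))"
    by (simp only: mult.assoc sum_product) (simp add: sum_distrib_left mult_ac)
  also have "\<dots> = (\<Sum>i\<in>UNIV. \<Sum>j\<in>UNIV. \<Sum>r\<in>UNIV. u $ i * w $ j * (?Q $ i $ r * a $ r * ?Q $ r $ j))"
    by (subst sum.swap, rule sum.cong[OF refl], rule sum.swap)
  also have "\<dots> = 0"
    by (simp only: sum_distrib_left[symmetric]
        hadamard_square_kernel[OF resid_proj_symmetric[OF inv] resid_proj_idempotent[OF inv] ker]) simp
  finally show ?thesis .
qed

section \<open>A matrix with nonsingular Hadamard square\<close>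

text \<open>
  This is where the inequality is used: with \<open>m = n - p\<close> it gives \<open>2 p \<le> m (m - 1)\<close>, so the \<open>m\<close>
  points outside the range of an injection \<open>q\<close> span at least \<open>p\<close> two-element sets.
\<close>
lemma exists_distinct_pairs_off_range:
  assumes "real CARD('n::finite) \<ge> real CARD('p::finite) + 1/2 + sqrt (2 * real CARD('p) + 1/4)"
  obtains q e f :: "'p::finite \<Rightarrow> 'n::finite" where "inj q" "inj (\<lambda>k. {e k, f k})"
    "\<And>k. e k \<noteq> f k" "\<And>k. e k \<notin> range q" "\<And>k. f k \<notin> range q"
proof -
  have "sqrt (2 * real CARD('p) + 1/4) \<ge> 0" by simp
  then have "real CARD('p) \<le> real CARD('n)" using assms by linarith
  then have pn: "CARD('p) \<le> CARD('n)" by simp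
  then obtain q :: "'p \<Rightarrow> 'n" where q: "inj q"
    using card_le_inj[of "UNIV::'p set" "UNIV::'n set"] by auto
  define m where "m = CARD('n) - CARD('p)"
  have cM: "card (- range q) = m"
    using q by (simp add: Compl_eq_Diff_UNIV card_Diff_subset card_image m_def)
  have "sqrt (2 * real CARD('p) + 1/4) \<le> real m - 1/2"
    using assms pn by (simp add: m_def of_nat_diff)
  then have "2 * real CARD('p) + 1/4 \<le> (real m - 1/2)\<^sup>2"
    by (rule sqrt_le_D)
  then have "2 * real CARD('p) \<le> real m * real m - real m"
    by (simp add: power2_eq_square algebra_simps)
  then have "real (2 * CARD('p) + m) \<le> real (m * m)" by simp
  then have "2 * CARD('p) + m \<le> m * m" by (simp only: of_nat_le_iff)
  then have "CARD('p) \<le> m choose 2"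
    by (cases m) (auto simp: choose_two)
  also have "\<dots> = card {S. S \<subseteq> - range q \<and> card S = 2}"
    by (simp add: n_subsets cM)
  finally obtain P where P: "P ` (UNIV::'p set) \<subseteq> {S. S \<subseteq> - range q \<and> card S = 2}" "inj P"
    using card_le_inj[of "UNIV::'p set" "{S. S \<subseteq> - range q \<and> card S = 2}"] by auto
  have "\<forall>k. \<exists>x y. P k = {x, y} \<and> x \<noteq> y"
    using P by (auto simp: card_2_iff image_subset_iff)
  then obtain e f where "\<And>k. P k = {e k, f k}" "\<And>k. e k \<noteq> f k"
    by metis
  with q P show thesis
    by (intro that[of q e f]) (auto simp: image_subset_iff inj_def)
qed

text \<open>
  Index the \<open>m\<close> unit vectors by the complement of \<open>range q\<close> and let row \<open>q k\<close> of \<open>V\<close> be the sum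
  of the unit vectors number \<open>e k\<close> and \<open>f k\<close>. Up to the order of rows, \<open>V\<close> consists of an identity
  block above a block \<open>W\<close>, and \<open>X\<close> of \<open>-W\<^sup>T\<close> above an identity block, so \<open>X\<^sup>T V = - W + W = 0\<close>.
  For \<open>a\<close> in the kernel of \<open>Q \<odot> Q\<close>, the product of columns \<open>e k\<close> and \<open>f k\<close> of \<open>V\<close> isolates the
  coefficient of row \<open>q k\<close>, because the pairs are distinct; once these coefficients vanish, the
  square of column \<open>l\<close> isolates the coefficient of row \<open>l\<close>.
\<close>
lemma exists_nonsingular_hadamard_square:
  assumes "real CARD('n::finite) \<ge> real CARD('p::finite) + 1/2 + sqrt (2 * real CARD('p) + 1/4)"
  obtains X :: "real^'p^'n" where "invertible (transpose X ** X)"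
    "rank (resid_proj X \<odot> resid_proj X) = CARD('n)"
proof -
  obtain q e f :: "'p \<Rightarrow> 'n" where q: "inj q" and ef: "inj (\<lambda>k. {e k, f k})"
    "\<And>k. e k \<noteq> f k" and M: "\<And>k. e k \<notin> range q" "\<And>k. f k \<notin> range q"
    by (rule exists_distinct_pairs_off_range[OF assms]) blast
  define X :: "real^'p^'n" where
    "X = (\<chi> r k. of_bool (r = q k) - of_bool (r = e k) - of_bool (r = f k))"
  \<comment> \<open>For \<open>l\<close> outside \<open>range q\<close>, \<open>v l\<close> is column \<open>l\<close> of \<open>V\<close>; the sum has at most one nonzero term.\<close>
  define v :: "'n \<Rightarrow> real^'n" where
    "v l = (\<chi> r. of_bool (r = l) + (\<Sum>k\<in>UNIV. of_bool (r = q k) * of_bool (l = e k \<or> l = f k)))" for l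
  have qq: "q k = q k' \<longleftrightarrow> k = k'" for k k' using q by (auto simp: inj_def)
  have Mq: "e k \<noteq> q k'" "q k' \<noteq> e k" "f k \<noteq> q k'" "q k' \<noteq> f k" for k k' using M by (metis rangeI)+
  have ind: "(\<Sum>r\<in>UNIV. of_bool (r = s) * g r) = g s" for s :: "'b::finite" and g :: "'b \<Rightarrow> real"
    by (simp add: of_bool_def if_distrib[of "\<lambda>x. x * _"] cong: if_cong)
  have v_q: "v l $ q k = of_bool (l = e k \<or> l = f k)" if "l \<notin> range q" for l k
  proof -
    have "q k \<noteq> l" using that by auto
    have "(\<Sum>k'\<in>UNIV. of_bool (q k = q k') * (of_bool (l = e k' \<or> l = f k') :: real)) =
       (\<Sum>k'\<in>UNIV. of_bool (k' = k) * of_bool (l = e k' \<or> l = f k'))"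
      by (simp add: qq eq_commute)
    then show ?thesis using \<open>q k \<noteq> l\<close> unfolding ind by (simp add: v_def)
  qed
  have v_M: "v l $ r = of_bool (r = l)" if "r \<notin> range q" for l r
  proof -
    have "r \<noteq> q k" for k using that by auto
    then show ?thesis by (simp add: v_def)
  qed
  have v_ker: "transpose X *v v l = 0" if l: "l \<notin> range q" for l
  proof -
    have "(transpose X *v v l) $ k = v l $ q k - v l $ e k - v l $ f k" for k
      by (simp add: matrix_vector_mult_def transpose_def X_def left_diff_distrib sum_subtractf ind
          del: transpose_matrix_vector)
    also have "\<dots> k = 0" for k
      using M ef(2)[of k] by (auto simp: v_q[OF l] v_M)
    finally show ?thesis by (simp add: vec_eq_iff del: transpose_matrix_vector)
  qed
  have inv: "invertible (transpose X ** X)"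
  proof -
    have "y = 0" if "(transpose X ** X) *v y = 0" for y
    proof -
      have "(X *v y) \<bullet> (X *v y) = y \<bullet> ((transpose X ** X) *v y)"
        by (metis dot_lmul_matrix inner_commute matrix_vector_mul_assoc transpose_matrix_vector)
      then have "X *v y = 0" using that by simp
      moreover have "(X *v y) $ q k = y $ k" for k
        by (simp add: matrix_vector_mult_def X_def Mq qq eq_commute[of k] ind)
      ultimately show ?thesis by (simp add: vec_eq_iff)
    qed
    then show ?thesis
      by (simp add: invertible_left_inverse matrix_left_invertible_ker)
  qed
  have "a = 0" if a: "(resid_proj X \<odot> resid_proj X) *v a = 0" for a
  proof -
    note ann = hadamard_kernel_annihilates_products[OF inv a v_ker v_ker]
    \<comment> \<open>Rows of \<open>V\<close> in the block \<open>W\<close>, then rows in the identity block.\<close>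
    have split: "(\<Sum>r\<in>UNIV. g r) = (\<Sum>k\<in>UNIV. g (q k)) + (\<Sum>r\<in>- range q. g r)" for g :: "'n \<Rightarrow> real"
    proof -
      have "(\<Sum>r\<in>UNIV. g r) = sum g (range q) + sum g (- range q)"
        by (metis Compl_disjoint Compl_partition finite sum.union_disjoint)
      then show ?thesis by (simp add: sum.reindex[OF q] o_def)
    qed
    have aq: "a $ q k = 0" for k
    proof -
      have pair: "(e k = e k' \<or> e k = f k') \<and> (f k = e k' \<or> f k = f k') \<longleftrightarrow> k' = k" for k'
        using ef(1) ef(2)[of k] ef(2)[of k'] unfolding inj_def by (metis insert_commute)
      have "0 = (\<Sum>k'\<in>UNIV. a $ q k' * v (e k) $ q k' * v (f k) $ q k')
          + (\<Sum>r\<in>- range q. a $ r * v (e k) $ r * v (f k) $ r)"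
        using ann[OF M(1)[of k] M(2)[of k]] by (simp add: split)
      also have "(\<Sum>r\<in>- range q. a $ r * v (e k) $ r * v (f k) $ r) = 0"
        using ef(2)[of k] by (intro sum.neutral) (auto simp: v_M)
      also have "(\<Sum>k'\<in>UNIV. a $ q k' * v (e k) $ q k' * v (f k) $ q k') =
          (\<Sum>k'\<in>UNIV. of_bool (k' = k) * a $ q k')"
        using pair by (intro sum.cong refl) (auto simp: v_q[OF M(1)] v_q[OF M(2)])
      finally show ?thesis by (simp add: ind)
    qed
    have "a $ l = 0" if l: "l \<notin> range q" for l
    proof -
      have "0 = (\<Sum>r\<in>- range q. a $ r * v l $ r * v l $ r)"
        using ann[OF l l] by (simp add: split aq)
      also have "\<dots> = (\<Sum>r\<in>- range q. if r = l then a $ r else 0)"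
        by (intro sum.cong refl) (auto simp: v_M)
      finally show ?thesis using l by simp
    qed
    with aq have "a $ i = 0" for i by (cases "i \<in> range q") auto
    then show ?thesis by (simp add: vec_eq_iff)
  qed
  then have "rank (resid_proj X \<odot> resid_proj X) = CARD('n)"
    using matrix_nonfull_linear_equations_eq[of "resid_proj X \<odot> resid_proj X"] by blast
  with inv show thesis by (rule that)
qed

theorem mainTheorem2:
  assumes "real CARD('n::finite) \<ge> real CARD('p::finite) + 1/2 + sqrt (2 * real CARD('p) + 1/4)"
  shows "{X :: real^'p^'n. invertible (transpose X ** X) \<and>
            rank (resid_proj X \<odot> resid_proj X) \<noteq> CARD('n)} \<in> null_sets lebesgue"
proof -
  obtain X\<^sub>0 :: "real^'p^'n" where "invertible (transpose X\<^sub>0 ** X\<^sub>0)"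
    "rank (resid_proj X\<^sub>0 \<odot> resid_proj X\<^sub>0) = CARD('n)"
    using exists_nonsingular_hadamard_square[OF assms] by blast
  then have "det (cleared_resid_proj X\<^sub>0 \<odot> cleared_resid_proj X\<^sub>0) \<noteq> 0"
    by (simp add: det_cleared_eq_0_iff)
  then have "{X::real^'p^'n. det (cleared_resid_proj X \<odot> cleared_resid_proj X) = 0} \<in> null_sets lebesgue"
    by (rule null_sets_real_polynomial_zeros[OF real_polynomial_function_det_cleared])
  then show ?thesis
    by (rule null_sets_completion_subset[rotated]) (auto simp: det_cleared_eq_0_iff)
qed

end
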